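(* Let $H$ be a real Hilbert space, let $\Omega$ be a nonempty convex subset of $H$, and let $g:\Omega\to\mathbb{R}$ be given. (a) Let $y\in\Omega$ and $t\in H$. Then $g$ is zero-convex at $y$ with respect to $t$ if and only if there exists a function $\psi:\mathbb{R}\to\mathbb{R}$ satisfying $\psi(r)\leq 0$ for all $r\leq 0$ such that $$g(y)+\langle t,x-y\rangle\leq\psi(g(x))\quad\text{for all } x\in g^{\leq 0}.$$ (b) If $g$ is zero-convex, then its zero-level-set $g^{\leq 0}$ is convex. (c) If $g^{\leq 0}$ is closed and convex, then $g$ is zero-convex. In fact, if $y\in g^{\leq 0}$, then $0\in\partial^0 g(y)$, and if $y\in\Omega$, $y\notin g^{\leq 0}$, then $$t=\frac{g(y)}{\|y-m\|^2}(y-m)$$ belongs to $\partial^0 g(y)$, where $m\in M$ is the orthogonal projection of $y$ onto a (closed) hyperplane $M$ strictly separating $y$ from $g^{\leq 0}$. (d) If $g^{\leq 0}$ is nonempty, closed and convex, $y\in\Omega$, $y\notin g^{\leq 0}$, and $m$ is the (unique) orthogonal projection of $y$ onto $g^{\leq 0}$, then $t=\frac{g(y)}{\|y-m\|^2}(y-m)$ belongs to $\partial^0 g(y)$.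
   Context: For $g:\Omega\to\mathbb{R}$, $g^{\leq 0}=\{x\in\Omega : g(x)\leq 0\}$ is the zero-level-set of $g$ (closedness refers to $H$). A vector $t\in H$ is a $0$-subgradient of $g$ at $y\in\Omega$ if $g(y)+\langle t,x-y\rangle\leq 0$ for all $x\in g^{\leq 0}$; the set of all $0$-subgradients at $y$ is denoted $\partial^0 g(y)$. $g$ is zero-convex at $y$ with respect to $t$ if $t\in\partial^0 g(y)$; $g$ is zero-convex at $y$ if $\partial^0 g(y)\neq\emptyset$; $g$ is zero-convex if it is zero-convex at every $y\in\Omega$. A closed hyperplane $M$ strictly separates $y$ from $g^{\leq 0}$ if $y$ lies in one of the two open half-spaces determined by $M$ and $g^{\leq 0}$ is contained in the union of $M$ and the other open half-space. *)

theory Defs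
  imports "HOL-Analysis.Analysis"
begin

text \<open>
  A function \<open>g : \<Omega> \<rightarrow> \<real>\<close> is represented by a total function together with its domain
  \<open>\<Omega>\<close>; only the values of \<open>g\<close> on \<open>\<Omega>\<close> are ever used.
\<close>

definition zero_level_set :: "'a set \<Rightarrow> ('a \<Rightarrow> real) \<Rightarrow> 'a set" where
  "zero_level_set \<Omega> g = {x \<in> \<Omega>. g x \<le> 0}"

definition zero_subdiff :: "'a::real_inner set \<Rightarrow> ('a \<Rightarrow> real) \<Rightarrow> 'a \<Rightarrow> 'a set" where
  "zero_subdiff \<Omega> g y = {t. \<forall>x \<in> zero_level_set \<Omega> g. g y + t \<bullet> (x - y) \<le> 0}"

definition zero_convex_at_wrt ::
    "'a::real_inner set \<Rightarrow> ('a \<Rightarrow> real) \<Rightarrow> 'a \<Rightarrow> 'a \<Rightarrow> bool" where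
  "zero_convex_at_wrt \<Omega> g y t \<longleftrightarrow> t \<in> zero_subdiff \<Omega> g y"

definition zero_convex_at :: "'a::real_inner set \<Rightarrow> ('a \<Rightarrow> real) \<Rightarrow> 'a \<Rightarrow> bool" where
  "zero_convex_at \<Omega> g y \<longleftrightarrow> zero_subdiff \<Omega> g y \<noteq> {}"

definition zero_convex :: "'a::real_inner set \<Rightarrow> ('a \<Rightarrow> real) \<Rightarrow> bool" where
  "zero_convex \<Omega> g \<longleftrightarrow> (\<forall>y \<in> \<Omega>. zero_convex_at \<Omega> g y)"

text \<open>
  A closed hyperplane is a level set \<open>{x. f x = c}\<close> of a nonzero continuous linear functional;
  the two open half-spaces it determines do not depend on the choice of \<open>f\<close> and \<open>c\<close>.
\<close>

definition strictly_separates ::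
    "'a::real_normed_vector set \<Rightarrow> 'a \<Rightarrow> 'a set \<Rightarrow> bool" where
  "strictly_separates M y S \<longleftrightarrow>
    (\<exists>(f :: 'a \<Rightarrow> real) c. bounded_linear f \<and> (\<exists>x. f x \<noteq> 0) \<and> M = {x. f x = c} \<and>
      (y \<in> {x. f x < c} \<and> S \<subseteq> M \<union> {x. f x > c} \<or>
       y \<in> {x. f x > c} \<and> S \<subseteq> M \<union> {x. f x < c}))"

text \<open>
  Orthogonal projection as nearest point. It is a relation because the library function
  \<open>closest_point\<close> requires the Heine-Borel property, which excludes infinite dimension.
\<close>

definition is_projection :: "'a::metric_space set \<Rightarrow> 'a \<Rightarrow> 'a \<Rightarrow> bool" where
  "is_projection S y m \<longleftrightarrow> m \<in> S \<and> (\<forall>x \<in> S. dist y m \<le> dist y x)"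

end

theory Submission
  imports Defs
begin

text \<open>
  Write \<open>S\<close> for the zero-level-set. For (a), take \<open>\<psi> = 0\<close> in one direction; in the other, \<open>\<psi>\<close> is only
  ever evaluated at nonpositive arguments. For (b), let \<open>z\<close> be a convex combination of two points
  of \<open>S\<close>. A \<open>0\<close>-subgradient \<open>t\<close> at \<open>z\<close> gives an affine function \<open>x \<mapsto> g z + t \<bullet> (x - z)\<close> that is
  nonpositive at both points, hence nonpositive at \<open>z\<close>, where its value is \<open>g z\<close>.

  In (c) and (d) the vector \<open>t = (g y / (norm (y - m))\<^sup>2) *\<^sub>R (y - m)\<close> is scaled so that the
  affine function \<open>x \<mapsto> g y + t \<bullet> (x - y)\<close> vanishes at \<open>m\<close>: it equals
  \<open>(g y / (norm (y - m))\<^sup>2) * ((y - m) \<bullet> (x - m))\<close>. Since \<open>g y > 0\<close>, both claims reduce to the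
  obtuse-angle inequality \<open>(y - m) \<bullet> (x - m) \<le> 0\<close> for \<open>x \<in> S\<close>
  (\<open>scaled_residual_in_zero_subdiff\<close>). When \<open>m\<close> is the projection onto \<open>S\<close> itself this is the
  usual variational inequality. When \<open>m\<close> is the projection onto a separating hyperplane \<open>M\<close>, the
  segment from \<open>y\<close> to \<open>x\<close> meets \<open>M\<close>; the inequality holds at the meeting point and fails at \<open>y\<close>,
  so, being affine along the segment, it holds at \<open>x\<close> as well
  (\<open>projection_obtuse_beyond\<close>).

  Completeness enters only through the existence of projections onto nonempty closed convex sets
  (\<open>ex1_projection\<close>). It also yields a separating hyperplane, namely the one through the
  projection \<open>m\<close> of \<open>y\<close> onto \<open>S\<close> with normal \<open>y - m\<close>.
\<close>

section \<open>Projections onto closed convex sets\<close>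

lemma parallelogram_midpoint:
  fixes p q y :: "'a::real_inner"
  shows "(dist p q)\<^sup>2 = 2 * (dist y p)\<^sup>2 + 2 * (dist y q)\<^sup>2 - 4 * (dist y (midpoint p q))\<^sup>2"
proof -
  define a b where "a = y - p" and "b = y - q"
  have "y = (1/2) *\<^sub>R y + (1/2) *\<^sub>R y"
    by (simp flip: scaleR_add_left)
  then have "y - midpoint p q = (1/2) *\<^sub>R (a + b)"
    unfolding a_def b_def midpoint_def by (simp add: algebra_simps)
  moreover have "p - q = b - a"
    by (simp add: a_def b_def)
  ultimately have "(dist p q)\<^sup>2 = (norm (b - a))\<^sup>2"
      "(dist y (midpoint p q))\<^sup>2 = (norm (a + b))\<^sup>2 / 4"
    by (simp_all add: dist_norm power_divide)
  moreover have "(dist y p)\<^sup>2 = (norm a)\<^sup>2" "(dist y q)\<^sup>2 = (norm b)\<^sup>2"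
    by (simp_all add: dist_norm a_def b_def)
  ultimately show ?thesis
    by (simp add: power2_norm_eq_inner inner_add inner_diff inner_commute)
qed

text \<open>
  The points of \<open>S\<close> whose distance to \<open>y\<close> exceeds the infimum by at most \<open>1/(n+1)\<close> form a
  decreasing sequence of nonempty closed sets. Midpoints stay in \<open>S\<close>, so the parallelogram law
  makes the diameters tend to \<open>0\<close>, and completeness provides a common point.
\<close>
lemma ex1_projection:
  fixes S :: "'a::{real_inner, complete_space} set"
  assumes "S \<noteq> {}" "closed S" "convex S"
  shows "\<exists>!m. is_projection S y m"
proof (rule ex_ex1I)
  define d where "d = infdist y S"
  define r where "r n = d + inverse (real (Suc n))" for n
  define C where "C n = S \<inter> cball y (r n)" for n
  have d_le: "d \<le> dist y x" if "x \<in> S" for x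
    using that by (simp add: d_def infdist_le)
  have "d \<ge> 0"
    by (simp add: d_def infdist_nonneg)
  obtain m where m: "\<And>n. m \<in> C n"
  proof (rule decreasing_closed_nest[of C])
    show thesis if "\<And>n. a \<in> C n" and "\<And>m. (\<And>n. m \<in> C n) \<Longrightarrow> thesis" for a
      using that by blast
    show "closed (C n)" for n
      using \<open>closed S\<close> by (simp add: C_def closed_Int)
    show "C n \<noteq> {}" for n
    proof -
      have "infdist y S < r n"
        by (simp add: r_def d_def)
      then obtain x where "x \<in> S" "dist y x < r n"
        unfolding infdist_notempty[OF \<open>S \<noteq> {}\<close>]
        using cInf_lessD[of "dist y ` S"] \<open>S \<noteq> {}\<close> by auto
      then show ?thesis
        by (force simp: C_def)
    qed
    show "C n \<subseteq> C k" if "k \<le> n" for k n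
    proof -
      have "r n \<le> r k"
        using that by (simp add: r_def field_simps)
      then show ?thesis
        by (auto simp: C_def)
    qed
    show "\<exists>n. \<forall>p\<in>C n. \<forall>q\<in>C n. dist p q < \<epsilon>" if "\<epsilon> > 0" for \<epsilon>
    proof -
      have "r \<longlonglongrightarrow> d + 0"
        unfolding r_def by (intro tendsto_intros LIMSEQ_inverse_real_of_nat)
      then have "(\<lambda>n. 4 * (r n)\<^sup>2 - 4 * d\<^sup>2) \<longlonglongrightarrow> 4 * (d + 0)\<^sup>2 - 4 * d\<^sup>2"
        by (intro tendsto_intros)
      moreover have "4 * (d + 0)\<^sup>2 - 4 * d\<^sup>2 < \<epsilon>\<^sup>2"
        using zero_less_power[OF \<open>\<epsilon> > 0\<close>, of 2] by simp
      ultimately have "eventually (\<lambda>n. 4 * (r n)\<^sup>2 - 4 * d\<^sup>2 < \<epsilon>\<^sup>2) sequentially"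
        by (rule order_tendstoD(2))
      then obtain n where n: "4 * (r n)\<^sup>2 - 4 * d\<^sup>2 < \<epsilon>\<^sup>2"
        by (auto simp: eventually_sequentially)
      have "dist p q < \<epsilon>" if "p \<in> C n" "q \<in> C n" for p q
      proof -
        have "midpoint p q \<in> S"
          using that convexD[OF \<open>convex S\<close>, of p q "1/2" "1/2"]
          by (simp add: C_def midpoint_def scaleR_add_right)
        then have "d\<^sup>2 \<le> (dist y (midpoint p q))\<^sup>2"
          using d_le \<open>d \<ge> 0\<close> by (intro power_mono)
        moreover have "(dist y p)\<^sup>2 \<le> (r n)\<^sup>2" "(dist y q)\<^sup>2 \<le> (r n)\<^sup>2"
          using that by (auto simp: C_def intro!: power_mono)
        ultimately have "(dist p q)\<^sup>2 < \<epsilon>\<^sup>2"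
          using n unfolding parallelogram_midpoint[of p q y] by linarith
        then show ?thesis
          using \<open>\<epsilon> > 0\<close> by (simp add: power_less_imp_less_base)
      qed
      then show ?thesis
        by blast
    qed
  qed
  have "r \<longlonglongrightarrow> d + 0"
    unfolding r_def by (intro tendsto_intros LIMSEQ_inverse_real_of_nat)
  then have "dist y m \<le> d"
    using m by (intro LIMSEQ_le_const[of r d]) (auto simp: C_def)
  then have "is_projection S y m"
    using m[of 0] d_le by (force simp: is_projection_def C_def)
  then show "\<exists>m. is_projection S y m" ..
  show "m = m'" if "is_projection S y m" "is_projection S y m'" for m m'
    using that any_closest_point_unique[OF \<open>convex S\<close> \<open>closed S\<close>, of m m' y]
    by (auto simp: is_projection_def)
qed

text \<open>
  The function \<open>z \<mapsto> (y - m) \<bullet> (z - m)\<close> is affine. It is nonnegative at \<open>y\<close> and, by the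
  variational inequality, nonpositive at the point \<open>y + s *\<^sub>R (x - y)\<close> of \<open>C\<close>, so it is
  nonpositive further along the ray, at \<open>x\<close>. Taking \<open>s = 1\<close> gives the case \<open>x \<in> C\<close>.
\<close>
lemma projection_obtuse_beyond:
  fixes C :: "'a::real_inner set"
  assumes "convex C" "closed C" "is_projection C y m"
    and "0 < s" "s \<le> 1" "y + s *\<^sub>R (x - y) \<in> C"
  shows "(y - m) \<bullet> (x - m) \<le> 0"
proof -
  have "(y - m) \<bullet> (y + s *\<^sub>R (x - y) - m) \<le> 0"
    using assms any_closest_point_dot[OF assms(1,2), of m _ y] by (auto simp: is_projection_def)
  also have "y + s *\<^sub>R (x - y) - m = (1 - s) *\<^sub>R (y - m) + s *\<^sub>R (x - m)"
    by (simp add: algebra_simps)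
  finally have "(1 - s) * ((y - m) \<bullet> (y - m)) + s * ((y - m) \<bullet> (x - m)) \<le> 0"
    by (simp only: inner_add_right inner_scaleR_right)
  moreover have "0 \<le> (1 - s) * ((y - m) \<bullet> (y - m))"
    using \<open>s \<le> 1\<close> by simp
  ultimately have "s * ((y - m) \<bullet> (x - m)) \<le> 0"
    by linarith
  then show ?thesis
    using \<open>0 < s\<close> by (simp add: mult_le_0_iff)
qed

section \<open>Zero-subgradients and zero-convexity\<close>

lemma scaled_residual_in_zero_subdiff:
  assumes "0 \<le> g y" "y \<noteq> m"
    and obtuse: "\<And>x. x \<in> zero_level_set \<Omega> g \<Longrightarrow> (y - m) \<bullet> (x - m) \<le> 0"
  shows "(g y / (norm (y - m))\<^sup>2) *\<^sub>R (y - m) \<in> zero_subdiff \<Omega> g y"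
proof -
  have "g y + ((g y / (norm (y - m))\<^sup>2) *\<^sub>R (y - m)) \<bullet> (x - y) \<le> 0"
    if "x \<in> zero_level_set \<Omega> g" for x
  proof -
    have "(y - m) \<bullet> (x - y) = (y - m) \<bullet> (x - m) - (norm (y - m))\<^sup>2"
      by (simp add: power2_norm_eq_inner flip: inner_diff_right)
    then have "g y + ((g y / (norm (y - m))\<^sup>2) *\<^sub>R (y - m)) \<bullet> (x - y) =
        (g y / (norm (y - m))\<^sup>2) * ((y - m) \<bullet> (x - m))"
      using \<open>y \<noteq> m\<close> by (simp add: right_diff_distrib)
    also have "\<dots> \<le> 0"
      using \<open>0 \<le> g y\<close> obtuse[OF that] by (intro mult_nonneg_nonpos) simp_all
    finally show ?thesis .
  qed
  then show ?thesis
    by (simp add: zero_subdiff_def)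
qed

lemma zero_convex_at_wrt_iff_majorant:
  "zero_convex_at_wrt \<Omega> g y t \<longleftrightarrow>
    (\<exists>\<psi> :: real \<Rightarrow> real. (\<forall>r \<le> 0. \<psi> r \<le> 0) \<and>
      (\<forall>x \<in> zero_level_set \<Omega> g. g y + t \<bullet> (x - y) \<le> \<psi> (g x)))"
proof
  assume "zero_convex_at_wrt \<Omega> g y t"
  then show "\<exists>\<psi> :: real \<Rightarrow> real. (\<forall>r \<le> 0. \<psi> r \<le> 0) \<and>
      (\<forall>x \<in> zero_level_set \<Omega> g. g y + t \<bullet> (x - y) \<le> \<psi> (g x))"
    by (intro exI[of _ "\<lambda>_. 0"]) (simp add: zero_convex_at_wrt_def zero_subdiff_def)
next
  assume "\<exists>\<psi> :: real \<Rightarrow> real. (\<forall>r \<le> 0. \<psi> r \<le> 0) \<and>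
      (\<forall>x \<in> zero_level_set \<Omega> g. g y + t \<bullet> (x - y) \<le> \<psi> (g x))"
  then show "zero_convex_at_wrt \<Omega> g y t"
    by (force simp: zero_convex_at_wrt_def zero_subdiff_def zero_level_set_def)
qed

lemma convex_zero_level_set:
  assumes "convex \<Omega>" "zero_convex \<Omega> g"
  shows "convex (zero_level_set \<Omega> g)"
proof (rule convexI)
  fix p q and u v :: real
  assume p: "p \<in> zero_level_set \<Omega> g" and q: "q \<in> zero_level_set \<Omega> g"
    and uv: "0 \<le> u" "0 \<le> v" "u + v = 1"
  define z where "z = u *\<^sub>R p + v *\<^sub>R q"
  have "z \<in> \<Omega>"
    unfolding z_def using p q uv by (intro convexD[OF \<open>convex \<Omega>\<close>]) (auto simp: zero_level_set_def)
  then obtain t where "t \<in> zero_subdiff \<Omega> g z"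
    using \<open>zero_convex \<Omega> g\<close> by (auto simp: zero_convex_def zero_convex_at_def)
  then have "g z + t \<bullet> (p - z) \<le> 0" "g z + t \<bullet> (q - z) \<le> 0"
    using p q by (auto simp: zero_subdiff_def)
  then have "u * (g z + t \<bullet> (p - z)) + v * (g z + t \<bullet> (q - z)) \<le> 0"
    using uv by (intro add_nonpos_nonpos[OF mult_nonneg_nonpos mult_nonneg_nonpos])
  also have "u * (g z + t \<bullet> (p - z)) + v * (g z + t \<bullet> (q - z)) =
      (u + v) * g z + t \<bullet> (z - (u + v) *\<^sub>R z)"
    by (simp add: z_def inner_diff_right inner_add_right algebra_simps)
  finally have "g z \<le> 0"
    using uv by simp
  then show "u *\<^sub>R p + v *\<^sub>R q \<in> zero_level_set \<Omega> g"
    using \<open>z \<in> \<Omega>\<close> by (simp add: zero_level_set_def z_def)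
qed

lemma zero_in_zero_subdiff:
  "y \<in> zero_level_set \<Omega> g \<Longrightarrow> 0 \<in> zero_subdiff \<Omega> g y"
  by (simp add: zero_level_set_def zero_subdiff_def)

lemma projection_residual_in_zero_subdiff:
  assumes "closed (zero_level_set \<Omega> g)" "convex (zero_level_set \<Omega> g)"
    and "y \<in> \<Omega> - zero_level_set \<Omega> g" "is_projection (zero_level_set \<Omega> g) y m"
  shows "(g y / (norm (y - m))\<^sup>2) *\<^sub>R (y - m) \<in> zero_subdiff \<Omega> g y"
proof (rule scaled_residual_in_zero_subdiff)
  show "0 \<le> g y"
    using assms(3) by (auto simp: zero_level_set_def)
  show "y \<noteq> m"
    using assms(3,4) by (auto simp: is_projection_def)
  show "(y - m) \<bullet> (x - m) \<le> 0" if "x \<in> zero_level_set \<Omega> g" for x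
    using projection_obtuse_beyond[OF assms(2,1,4), of 1 x] that by simp
qed

text \<open>
  Where the zero-level-set is empty there is nothing to project onto, but then every vector is a
  \<open>0\<close>-subgradient.
\<close>
lemma zero_convex_if_closed_convex_level_set:
  fixes \<Omega> :: "'a::{real_inner, complete_space} set"
  assumes "closed (zero_level_set \<Omega> g)" "convex (zero_level_set \<Omega> g)"
  shows "zero_convex \<Omega> g"
proof -
  have "zero_subdiff \<Omega> g y \<noteq> {}" if "y \<in> \<Omega>" for y
  proof -
    consider "y \<in> zero_level_set \<Omega> g" | "zero_level_set \<Omega> g = {}"
      | "zero_level_set \<Omega> g \<noteq> {}" "y \<in> \<Omega> - zero_level_set \<Omega> g"
      using \<open>y \<in> \<Omega>\<close> by blast
    then show ?thesis
    proof cases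
      case 1
      then show ?thesis
        using zero_in_zero_subdiff by blast
    next
      case 2
      then show ?thesis
        by (simp add: zero_subdiff_def)
    next
      case 3
      then show ?thesis
        using ex1_projection[OF _ assms] projection_residual_in_zero_subdiff[OF assms] by blast
    qed
  qed
  then show ?thesis
    by (simp add: zero_convex_def zero_convex_at_def)
qed

section \<open>Separating hyperplanes\<close>

text \<open>
  For nonempty \<open>S\<close> the hyperplane passes through the projection \<open>m\<close> of \<open>y\<close> onto \<open>S\<close>, orthogonally to
  \<open>y - m\<close>. For empty \<open>S\<close> any hyperplane avoiding \<open>y\<close> will do, and one exists because the space is
  nontrivial.
\<close>
lemma ex_strictly_separating_hyperplane:
  fixes S :: "'a::{real_inner, complete_space} set"
  assumes "closed S" "convex S" "y \<notin> S" "\<exists>u :: 'a. u \<noteq> 0"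
  shows "\<exists>M. strictly_separates M y S"
proof -
  have *: "\<exists>M. strictly_separates M y S"
    if "n \<noteq> 0" "n \<bullet> y > c" "\<forall>x\<in>S. n \<bullet> x \<le> c" for n c
  proof -
    have "bounded_linear ((\<bullet>) n)" "n \<bullet> n \<noteq> 0" "y \<in> {x. n \<bullet> x > c}"
        "S \<subseteq> {x. n \<bullet> x = c} \<union> {x. n \<bullet> x < c}"
      using that by (auto simp: bounded_linear_inner_right less_le)
    then show ?thesis
      unfolding strictly_separates_def by blast
  qed
  show ?thesis
  proof (cases "S = {}")
    case True
    obtain u :: 'a where "u \<noteq> 0"
      using assms(4) by blast
    then show ?thesis
      using *[of u "u \<bullet> y - 1"] True by simp
  next
    case False
    then obtain m where m: "is_projection S y m"
      using ex1_projection[OF _ assms(1,2)] by blast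
    then have "y \<noteq> m"
      using \<open>y \<notin> S\<close> by (auto simp: is_projection_def)
    then have "(y - m) \<bullet> (y - m) > 0"
      by simp
    moreover have "(y - m) \<bullet> (x - m) \<le> 0" if "x \<in> S" for x
      using projection_obtuse_beyond[OF assms(2,1) m, of 1 x] that by simp
    ultimately show ?thesis
      using \<open>y \<noteq> m\<close> by (intro *[of "y - m" "(y - m) \<bullet> m"]) (auto simp: inner_diff_right)
  qed
qed

lemma strictly_separates_hyperplane:
  assumes "strictly_separates M y S"
  shows "M \<noteq> {}" "closed M" "convex M" "y \<notin> M"
proof -
  obtain f :: "'a \<Rightarrow> real" and c x where f: "bounded_linear f" "f x \<noteq> 0" "M = {x. f x = c}"
      and "f y \<noteq> c"
    using assms by (auto simp: strictly_separates_def)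
  interpret bounded_linear f by fact
  have "(c / f x) *\<^sub>R x \<in> M"
    using f by (simp add: scaleR)
  then show "M \<noteq> {}" by blast
  show "closed M"
    unfolding f(3) by (intro closed_Collect_eq continuous_intros continuous_on)
  show "convex M"
    unfolding f(3) by (auto simp: convex_def add scaleR simp flip: distrib_right)
  show "y \<notin> M"
    using f \<open>f y \<noteq> c\<close> by simp
qed

text \<open>
  The functional defining \<open>M\<close> is affine along the segment, and \<open>s\<close> is the parameter at which it
  takes the level \<open>c\<close> of \<open>M\<close>.
\<close>
lemma strictly_separates_segment_meets:
  assumes "strictly_separates M y S" "x \<in> S"
  obtains s where "0 < s" "s \<le> 1" "y + s *\<^sub>R (x - y) \<in> M"
proof -
  obtain f :: "'a \<Rightarrow> real" and c where f: "bounded_linear f" "M = {x. f x = c}"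
      and sides: "f y < c \<and> c \<le> f x \<or> f y > c \<and> c \<ge> f x"
    using assms by (fastforce simp: strictly_separates_def)
  interpret bounded_linear f by fact
  define s where "s = (c - f y) / (f x - f y)"
  have "f x - f y \<noteq> 0"
    using sides by auto
  then have "y + s *\<^sub>R (x - y) \<in> M"
    by (simp add: f(2) add diff scaleR s_def)
  moreover have "0 < s" "s \<le> 1"
    using sides by (auto simp: s_def zero_less_divide_iff divide_le_eq)
  ultimately show thesis
    using that by blast
qed

lemma hyperplane_residual_in_zero_subdiff:
  assumes "y \<in> \<Omega> - zero_level_set \<Omega> g"
    and sep: "strictly_separates M y (zero_level_set \<Omega> g)" and m: "is_projection M y m"
  shows "(g y / (norm (y - m))\<^sup>2) *\<^sub>R (y - m) \<in> zero_subdiff \<Omega> g y"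
proof (rule scaled_residual_in_zero_subdiff)
  note M = strictly_separates_hyperplane[OF sep]
  show "0 \<le> g y"
    using assms(1) by (auto simp: zero_level_set_def)
  show "y \<noteq> m"
    using m M(4) by (auto simp: is_projection_def)
  show "(y - m) \<bullet> (x - m) \<le> 0" if "x \<in> zero_level_set \<Omega> g" for x
    using strictly_separates_segment_meets[OF sep that] projection_obtuse_beyond[OF M(3,2) m]
    by blast
qed

theorem proposition1:
  fixes \<Omega> :: "'a::{real_inner, complete_space} set"
    and g :: "'a \<Rightarrow> real"
  assumes "\<Omega> \<noteq> {}"
    and "convex \<Omega>"
  shows
    "(\<forall>y \<in> \<Omega>. \<forall>t.
        zero_convex_at_wrt \<Omega> g y t \<longleftrightarrow>
        (\<exists>\<psi> :: real \<Rightarrow> real. (\<forall>r \<le> 0. \<psi> r \<le> 0) \<and>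
          (\<forall>x \<in> zero_level_set \<Omega> g. g y + t \<bullet> (x - y) \<le> \<psi> (g x))))
   \<and> (zero_convex \<Omega> g \<longrightarrow> convex (zero_level_set \<Omega> g))
   \<and> (closed (zero_level_set \<Omega> g) \<and> convex (zero_level_set \<Omega> g) \<longrightarrow>
        zero_convex \<Omega> g
      \<and> (\<forall>y \<in> zero_level_set \<Omega> g. 0 \<in> zero_subdiff \<Omega> g y)
      \<and> (\<forall>y \<in> \<Omega> - zero_level_set \<Omega> g.
            ((\<exists>u :: 'a. u \<noteq> 0) \<longrightarrow> (\<exists>M. strictly_separates M y (zero_level_set \<Omega> g)))
          \<and> (\<forall>M. strictly_separates M y (zero_level_set \<Omega> g) \<longrightarrow>
                (\<exists>!m. is_projection M y m)
              \<and> (\<forall>m. is_projection M y m \<longrightarrow>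
                    (g y / (norm (y - m))\<^sup>2) *\<^sub>R (y - m) \<in> zero_subdiff \<Omega> g y))))
   \<and> (zero_level_set \<Omega> g \<noteq> {} \<and> closed (zero_level_set \<Omega> g) \<and> convex (zero_level_set \<Omega> g) \<longrightarrow>
        (\<forall>y \<in> \<Omega> - zero_level_set \<Omega> g.
            (\<exists>!m. is_projection (zero_level_set \<Omega> g) y m)
          \<and> (\<forall>m. is_projection (zero_level_set \<Omega> g) y m \<longrightarrow>
                (g y / (norm (y - m))\<^sup>2) *\<^sub>R (y - m) \<in> zero_subdiff \<Omega> g y)))"
proof (intro conjI impI ballI allI; (elim conjE)?)
  fix y t
  show "zero_convex_at_wrt \<Omega> g y t \<longleftrightarrow>
        (\<exists>\<psi> :: real \<Rightarrow> real. (\<forall>r \<le> 0. \<psi> r \<le> 0) \<and>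
          (\<forall>x \<in> zero_level_set \<Omega> g. g y + t \<bullet> (x - y) \<le> \<psi> (g x)))"
    by (rule zero_convex_at_wrt_iff_majorant)
next
  assume "zero_convex \<Omega> g"
  then show "convex (zero_level_set \<Omega> g)"
    by (rule convex_zero_level_set[OF \<open>convex \<Omega>\<close>])
next
  assume S: "closed (zero_level_set \<Omega> g)" "convex (zero_level_set \<Omega> g)"
  then show "zero_convex \<Omega> g"
    by (rule zero_convex_if_closed_convex_level_set)
next
  fix y
  assume "y \<in> zero_level_set \<Omega> g"
  then show "0 \<in> zero_subdiff \<Omega> g y"
    by (rule zero_in_zero_subdiff)
next
  fix y
  assume "closed (zero_level_set \<Omega> g)" "convex (zero_level_set \<Omega> g)"
    and "y \<in> \<Omega> - zero_level_set \<Omega> g" "\<exists>u :: 'a. u \<noteq> 0"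
  then show "\<exists>M. strictly_separates M y (zero_level_set \<Omega> g)"
    by (intro ex_strictly_separating_hyperplane) auto
next
  fix y M
  assume "strictly_separates M y (zero_level_set \<Omega> g)"
  then show "\<exists>!m. is_projection M y m"
    by (intro ex1_projection strictly_separates_hyperplane(1-3))
next
  fix y M m
  assume "y \<in> \<Omega> - zero_level_set \<Omega> g" "strictly_separates M y (zero_level_set \<Omega> g)"
    and "is_projection M y m"
  then show "(g y / (norm (y - m))\<^sup>2) *\<^sub>R (y - m) \<in> zero_subdiff \<Omega> g y"
    by (rule hyperplane_residual_in_zero_subdiff)
next
  fix y
  assume "zero_level_set \<Omega> g \<noteq> {}" "closed (zero_level_set \<Omega> g)" "convex (zero_level_set \<Omega> g)"
  then show "\<exists>!m. is_projection (zero_level_set \<Omega> g) y m"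
    by (rule ex1_projection)
next
  fix y m
  assume "closed (zero_level_set \<Omega> g)" "convex (zero_level_set \<Omega> g)"
    and "y \<in> \<Omega> - zero_level_set \<Omega> g" "is_projection (zero_level_set \<Omega> g) y m"
  then show "(g y / (norm (y - m))\<^sup>2) *\<^sub>R (y - m) \<in> zero_subdiff \<Omega> g y"
    by (rule projection_residual_in_zero_subdiff)
qed

end
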